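(* Let $(\mathcal{H},\tau,\le,\mathcal{I},\mathcal{R})$ be a financial market (as defined in the context). (1) The financial market is viable if and only if there exists a $\tau$-lower semi-continuous sublinear martingale expectation with full support. (2) If the financial market is viable, then the set $\mathcal{Q}_{ac}$ of absolutely continuous martingale functionals is not empty, and $$\mathcal{E}_{\mathcal{Q}_{ac}}(X):=\sup_{\phi\in\mathcal{Q}_{ac}}\phi(X),\qquad X\in\mathcal{H},$$ is a $\tau$-lower semi-continuous sublinear martingale expectation with full support. Moreover, $\mathcal{E}_{\mathcal{Q}_{ac}}$ is maximal, in the sense that any other $\tau$-lower semi-continuous sublinear martingale expectation with full support $\mathcal{E}$ satisfies $\mathcal{E}(X)\le\mathcal{E}_{\mathcal{Q}_{ac}}(X)$ for all $X\in\mathcal{H}$.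
   Context: Financial market: $(\Omega,\mathcal{F})$ is a nonempty measurable space. $\mathcal{H}$ is a vector space of $\mathcal{F}$-measurable real-valued functions on $\Omega$ containing all constant functions (a real number $c$ is identified with the constant function $c$). $\tau$ is a metrizable topology on $\mathcal{H}$ and $\le$ is a pre-order on $\mathcal{H}$, both compatible with the vector space operations. The pre-order $\le$ is consistent with the order of $\mathbb{R}$ on constant functions and with the pointwise order (if $X(\omega)\le Y(\omega)$ for all $\omega\in\Omega$, then $X\le Y$). A claim $Z$ is negligible if $0\le Z$ and $Z\le 0$. A claim $X\in\mathcal{H}$ is nonnegative if $0\le X$; the set of nonnegative claims is $\mathcal{P}$. $X$ is positive if $0\le X$ and not $X\le 0$; the set of positive claims is $\mathcal{P}^+$. The set of relevant claims $\mathcal{R}$ is a convex subset of $\mathcal{P}^+$ containing all constants $c\in(0,\infty)$. The set of net trades $\mathcal{I}\subset\mathcal{H}$ is a convex cone containing $0$. Agents: $\mathcal{A}$ is the set of complete and transitive binary relations $\preceq$ on $\mathcal{H}$ (with strict part $\prec$) that are (i) weakly monotone: $X\le Y$ implies $X\preceq Y$; (ii) convex: $\{Z\in\mathcal{H}: X\preceq Z\}$ is convex for every $X\in\mathcal{H}$; (iii) $\tau$-lower semi-continuous: if $X_n\to X$ in $\tau$ and $X_n\preceq Y$ for all $n$, then $X\preceq Y$. Viability: the market is viable if there is a family $\{\preceq_a\}_{a\in A}\subset\mathcal{A}$ such that $\ell\preceq_a 0$ for every $a\in A$ and $\ell\in\mathcal{I}$, and for every $R\in\mathcal{R}$ there is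 $a\in A$ with $0\prec_a R$. Sublinear martingale expectation with full support: a functional $\mathcal{E}:\mathcal{H}\to\mathbb{R}\cup\{\infty\}$ is a sublinear expectation if it is monotone with respect to $\le$, translation-invariant ($\mathcal{E}(X+c)=\mathcal{E}(X)+c$ for all $X\in\mathcal{H}$, $c\in\mathbb{R}$) and sublinear ($\mathcal{E}(X+Y)\le\mathcal{E}(X)+\mathcal{E}(Y)$ and $\mathcal{E}(\lambda X)=\lambda\mathcal{E}(X)$ for $X,Y\in\mathcal{H}$, $\lambda>0$). It has full support if $\mathcal{E}(R)>0$ for every $R\in\mathcal{R}$, and the martingale property if $\mathcal{E}(\ell)\le 0$ for every $\ell\in\mathcal{I}$. Martingale functionals: $\mathcal{H}'$ is the topological dual of $(\mathcal{H},\tau)$; $\mathcal{H}'_+$ is the set of $\varphi\in\mathcal{H}'$ with $\varphi(X)\ge0$ for every $X\in\mathcal{H}$ with $X\ge 0$. $\varphi\in\mathcal{H}'_+$ is a martingale functional if $\varphi(1)=1$ and $\varphi(\ell)\le0$ for all $\ell\in\mathcal{I}$; it is absolutely continuous if $\varphi(Z)=0$ for all negligible $Z$. $\mathcal{Q}_{ac}$ is the set of absolutely continuous martingale functionals.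
   Formalization: The topology τ is additionally assumed locally convex for the equivalence in (1) (needed only for "expectation exists ⇒ viable") and for the maximality claim in (2); both fail without it, e.g. on C[0,1] with convergence in measure. The rest holds for every market. *)

theory Defs
  imports "HOL-Analysis.Analysis" "HOL-Library.Function_Algebras"
begin

text \<open>
  Scalar multiplication on functions is pointwise, so that \<open>subspace\<close>, \<open>convex\<close> and
  \<open>convex_cone\<close> apply to sets of functions.
\<close>

instantiation "fun" :: (type, real_vector) real_vector
begin

definition scaleR_fun :: "real \<Rightarrow> ('a \<Rightarrow> 'b) \<Rightarrow> 'a \<Rightarrow> 'b" where
  "scaleR_fun c f = (\<lambda>x. c *\<^sub>R f x)"

instance
  by standard (simp_all add: scaleR_fun_def fun_eq_iff scaleR_add_left scaleR_add_right)

end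

text \<open>
  The set \<open>\<Omega>\<close> is the type \<open>'w\<close> (types are nonempty); only the sigma-algebra of \<open>M\<close> is used,
  never its measure.  The topology \<open>T\<close> has \<open>H\<close> as its carrier, and the relation \<open>le\<close> matters
  only on \<open>H\<close>.
\<close>

type_synonym 'w claim = "'w \<Rightarrow> real"

definition const_claim :: "real \<Rightarrow> 'w claim" where
  "const_claim c = (\<lambda>_. c)"

definition vector_topology_on :: "'w claim set \<Rightarrow> 'w claim topology \<Rightarrow> bool" where
  "vector_topology_on H T \<longleftrightarrow>
     topspace T = H \<and>
     continuous_map (prod_topology T T) T (\<lambda>(X, Y). X + Y) \<and>
     continuous_map (prod_topology euclideanreal T) T (\<lambda>(c, X). c *\<^sub>R X)"

definition vector_preorder_on :: "'w claim set \<Rightarrow> ('w claim \<Rightarrow> 'w claim \<Rightarrow> bool) \<Rightarrow> bool" where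
  "vector_preorder_on H le \<longleftrightarrow>
     reflp_on H le \<and> transp_on H le \<and>
     (\<forall>X\<in>H. \<forall>Y\<in>H. \<forall>Z\<in>H. le X Y \<longrightarrow> le (X + Z) (Y + Z)) \<and>
     (\<forall>X\<in>H. \<forall>Y\<in>H. \<forall>c\<ge>0. le X Y \<longrightarrow> le (c *\<^sub>R X) (c *\<^sub>R Y))"

definition negligible_claims :: "'w claim set \<Rightarrow> ('w claim \<Rightarrow> 'w claim \<Rightarrow> bool) \<Rightarrow> 'w claim set" where
  "negligible_claims H le = {Z \<in> H. le 0 Z \<and> le Z 0}"

definition nonneg_claims :: "'w claim set \<Rightarrow> ('w claim \<Rightarrow> 'w claim \<Rightarrow> bool) \<Rightarrow> 'w claim set" where
  "nonneg_claims H le = {X \<in> H. le 0 X}"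

definition pos_claims :: "'w claim set \<Rightarrow> ('w claim \<Rightarrow> 'w claim \<Rightarrow> bool) \<Rightarrow> 'w claim set" where
  "pos_claims H le = {X \<in> H. le 0 X \<and> \<not> le X 0}"

locale financial_market =
  fixes M :: "'w measure"
    and H :: "'w claim set"
    and T :: "'w claim topology"
    and le :: "'w claim \<Rightarrow> 'w claim \<Rightarrow> bool"
    and I :: "'w claim set"
    and R :: "'w claim set"
  assumes space_M: "space M = UNIV"
    and H_measurable: "H \<subseteq> borel_measurable M"
    and H_subspace: "subspace H"
    and H_const: "const_claim c \<in> H"
    and T_metrizable: "metrizable_space T"
    and T_vector: "vector_topology_on H T"
    and le_vector: "vector_preorder_on H le"
    and le_const: "le (const_claim c) (const_claim d) \<longleftrightarrow> c \<le> d"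
    and le_pointwise: "X \<in> H \<Longrightarrow> Y \<in> H \<Longrightarrow> (\<forall>w. X w \<le> Y w) \<Longrightarrow> le X Y"
    and R_pos: "R \<subseteq> pos_claims H le"
    and R_convex: "convex R"
    and R_const: "0 < c \<Longrightarrow> const_claim c \<in> R"
    and I_H: "I \<subseteq> H"
    and I_cone: "convex_cone I"
    and I_zero: "0 \<in> I"

text \<open>
  Local convexity of the topology is not one of the market assumptions.  Without it a lower
  semi-continuous sublinear functional need not be a supremum of continuous linear functionals.
\<close>

definition locally_convex_topology :: "'w claim topology \<Rightarrow> bool" where
  "locally_convex_topology T \<longleftrightarrow> neighbourhood_base_of convex T"

definition strict_pref :: "('w claim \<Rightarrow> 'w claim \<Rightarrow> bool) \<Rightarrow> 'w claim \<Rightarrow> 'w claim \<Rightarrow> bool" where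
  "strict_pref p X Y \<longleftrightarrow> p X Y \<and> \<not> p Y X"

definition agents ::
  "'w claim set \<Rightarrow> 'w claim topology \<Rightarrow> ('w claim \<Rightarrow> 'w claim \<Rightarrow> bool) \<Rightarrow>
   ('w claim \<Rightarrow> 'w claim \<Rightarrow> bool) set" where
  "agents H T le = {p.
     (\<forall>X\<in>H. \<forall>Y\<in>H. p X Y \<or> p Y X) \<and>
     transp_on H p \<and>
     (\<forall>X\<in>H. \<forall>Y\<in>H. le X Y \<longrightarrow> p X Y) \<and>
     (\<forall>X\<in>H. convex {Z \<in> H. p X Z}) \<and>
     (\<forall>Xs X. \<forall>Y\<in>H. range Xs \<subseteq> H \<longrightarrow> limitin T Xs X sequentially \<longrightarrow> (\<forall>n. p (Xs n) Y) \<longrightarrow> p X Y)}"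

text \<open>
  A family of agents is given by its range \<open>A\<close>: neither condition depends on the indexing.
\<close>

definition viable ::
  "'w claim set \<Rightarrow> 'w claim topology \<Rightarrow> ('w claim \<Rightarrow> 'w claim \<Rightarrow> bool) \<Rightarrow>
   'w claim set \<Rightarrow> 'w claim set \<Rightarrow> bool" where
  "viable H T le I R \<longleftrightarrow>
     (\<exists>A \<subseteq> agents H T le.
        (\<forall>p\<in>A. \<forall>l\<in>I. p l 0) \<and>
        (\<forall>X\<in>R. \<exists>p\<in>A. strict_pref p 0 X))"

text \<open>
  Functionals with values in \<open>\<real> \<union> {\<infinity>}\<close> are \<open>ereal\<close>-valued functions avoiding \<open>-\<infinity>\<close> on \<open>H\<close>.
\<close>

definition sublinear_expectation ::
  "'w claim set \<Rightarrow> ('w claim \<Rightarrow> 'w claim \<Rightarrow> bool) \<Rightarrow> ('w claim \<Rightarrow> ereal) \<Rightarrow> bool" where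
  "sublinear_expectation H le E \<longleftrightarrow>
     (\<forall>X\<in>H. E X \<noteq> -\<infinity>) \<and>
     (\<forall>X\<in>H. \<forall>Y\<in>H. le X Y \<longrightarrow> E X \<le> E Y) \<and>
     (\<forall>X\<in>H. \<forall>c. E (X + const_claim c) = E X + ereal c) \<and>
     (\<forall>X\<in>H. \<forall>Y\<in>H. E (X + Y) \<le> E X + E Y) \<and>
     (\<forall>X\<in>H. \<forall>c>0. E (c *\<^sub>R X) = ereal c * E X)"

definition full_support :: "'w claim set \<Rightarrow> ('w claim \<Rightarrow> ereal) \<Rightarrow> bool" where
  "full_support R E \<longleftrightarrow> (\<forall>X\<in>R. E X > 0)"

definition martingale_property :: "'w claim set \<Rightarrow> ('w claim \<Rightarrow> ereal) \<Rightarrow> bool" where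
  "martingale_property I E \<longleftrightarrow> (\<forall>l\<in>I. E l \<le> 0)"

text \<open>Sequences suffice because the topology is metrizable.\<close>

definition lower_semicontinuous ::
  "'w claim set \<Rightarrow> 'w claim topology \<Rightarrow> ('w claim \<Rightarrow> ereal) \<Rightarrow> bool" where
  "lower_semicontinuous H T E \<longleftrightarrow>
     (\<forall>Xs X. range Xs \<subseteq> H \<longrightarrow> limitin T Xs X sequentially \<longrightarrow> E X \<le> liminf (\<lambda>n. E (Xs n)))"

definition lsc_martingale_expectation ::
  "'w claim set \<Rightarrow> 'w claim topology \<Rightarrow> ('w claim \<Rightarrow> 'w claim \<Rightarrow> bool) \<Rightarrow>
   'w claim set \<Rightarrow> 'w claim set \<Rightarrow> ('w claim \<Rightarrow> ereal) \<Rightarrow> bool" where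
  "lsc_martingale_expectation H T le I R E \<longleftrightarrow>
     lower_semicontinuous H T E \<and> sublinear_expectation H le E \<and>
     martingale_property I E \<and> full_support R E"

text \<open>Functionals on \<open>H\<close> are normalised to be \<open>undefined\<close> outside \<open>H\<close>.\<close>

definition topological_dual :: "'w claim set \<Rightarrow> 'w claim topology \<Rightarrow> ('w claim \<Rightarrow> real) set" where
  "topological_dual H T = {\<phi> \<in> extensional H.
     (\<forall>X\<in>H. \<forall>Y\<in>H. \<phi> (X + Y) = \<phi> X + \<phi> Y) \<and>
     (\<forall>X\<in>H. \<forall>c. \<phi> (c *\<^sub>R X) = c * \<phi> X) \<and>
     continuous_map T euclideanreal \<phi>}"

definition positive_dual ::
  "'w claim set \<Rightarrow> 'w claim topology \<Rightarrow> ('w claim \<Rightarrow> 'w claim \<Rightarrow> bool) \<Rightarrow>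
   ('w claim \<Rightarrow> real) set" where
  "positive_dual H T le = {\<phi> \<in> topological_dual H T. \<forall>X \<in> nonneg_claims H le. \<phi> X \<ge> 0}"

definition martingale_functionals ::
  "'w claim set \<Rightarrow> 'w claim topology \<Rightarrow> ('w claim \<Rightarrow> 'w claim \<Rightarrow> bool) \<Rightarrow> 'w claim set \<Rightarrow>
   ('w claim \<Rightarrow> real) set" where
  "martingale_functionals H T le I =
     {\<phi> \<in> positive_dual H T le. \<phi> (const_claim 1) = 1 \<and> (\<forall>l\<in>I. \<phi> l \<le> 0)}"

definition Q_ac ::
  "'w claim set \<Rightarrow> 'w claim topology \<Rightarrow> ('w claim \<Rightarrow> 'w claim \<Rightarrow> bool) \<Rightarrow> 'w claim set \<Rightarrow>
   ('w claim \<Rightarrow> real) set" where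
  "Q_ac H T le I =
     {\<phi> \<in> martingale_functionals H T le I. \<forall>Z \<in> negligible_claims H le. \<phi> Z = 0}"

definition sup_expectation :: "('w claim \<Rightarrow> real) set \<Rightarrow> 'w claim \<Rightarrow> ereal" where
  "sup_expectation Q X = (SUP \<phi>\<in>Q. ereal (\<phi> X))"

end

theory Submission
  imports Defs
begin

text \<open>
  If an agent strictly prefers the claim \<open>X\<close> to \<open>0\<close>, the set of all claims she strictly prefers to
  \<open>0\<close> is convex by convexity and completeness, open by lower semi-continuity, and disjoint from the
  cone of claims dominated by a net trade.  Being open, it can be separated from that cone without
  local convexity, and the separating functional is a positive supermartingale functional charging
  \<open>X\<close>.  Given an expectation \<open>E\<close> instead, the cone \<open>{E \<le> 0}\<close> is closed, and local convexity
  separates it from \<open>X - r\<close> whenever \<open>r < E X\<close>.  In both cases a functional charging the constant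
  \<open>1\<close> is mixed in before normalising.  Conversely, a functional in \<open>Q_ac\<close> is the utility of a
  linear agent.

  The separation theorem rests on Zorn's lemma: a maximal convex cone avoiding \<open>u\<close> contains every
  vector or its opposite, hence is a half-space up to its boundary.
\<close>

section \<open>Algebraic separation: maximal convex cones and the linear functionals they
  determine\<close>

lemma exists_total_convex_cone:
  fixes K :: "'a::real_vector set"
  assumes K: "convex_cone K" and u: "u \<notin> K"
  shows "\<exists>C. convex_cone C \<and> K \<subseteq> C \<and> u \<notin> C \<and> (\<forall>y. y \<in> C \<or> - y \<in> C)"
proof -
  let ?F = "{C. convex_cone C \<and> K \<subseteq> C \<and> u \<notin> C}"
  have "\<exists>C\<in>?F. \<forall>X\<in>?F. C \<subseteq> X \<longrightarrow> X = C"
  proof (rule subset_Zorn_nonempty)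
    show "?F \<noteq> {}"
      using K u by blast
    fix \<C> assume ne: "\<C> \<noteq> {}" and ch: "subset.chain ?F \<C>"
    have mem: "\<And>C. C \<in> \<C> \<Longrightarrow> C \<in> ?F"
      using ch by (auto simp: subset.chain_def)
    \<comment> \<open>Two points of the union of a chain lie in a common member, so closure under
      addition passes to the union.\<close>
    have dir: "\<exists>E\<in>\<C>. x \<in> E \<and> y \<in> E" if xy: "x \<in> \<Union>\<C>" "y \<in> \<Union>\<C>" for x y
    proof -
      obtain X Y where "X \<in> \<C>" "Y \<in> \<C>" "x \<in> X" "y \<in> Y"
        using xy by blast
      moreover from this have "X \<subseteq> Y \<or> Y \<subseteq> X"
        using ch by (simp add: subset_chain_def)
      ultimately show ?thesis by blast
    qed
    have "convex_cone (\<Union>\<C>)"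
      unfolding convex_cone_iff
    proof (intro conjI ballI allI impI)
      show "0 \<in> \<Union>\<C>"
        using ne mem by (blast intro: convex_cone_contains_0)
    next
      fix x y assume "x \<in> \<Union>\<C>" "y \<in> \<Union>\<C>"
      with dir obtain E where "E \<in> \<C>" "x \<in> E" "y \<in> E" by blast
      then show "x + y \<in> \<Union>\<C>"
        using mem by (blast intro: convex_cone_add)
    next
      fix x and c :: real assume "x \<in> \<Union>\<C>" "0 \<le> c"
      then show "c *\<^sub>R x \<in> \<Union>\<C>"
        using mem by (blast intro: convex_cone_scaleR)
    qed
    moreover have "K \<subseteq> \<Union>\<C>" "u \<notin> \<Union>\<C>"
      using ne mem by blast+
    ultimately show "\<Union>\<C> \<in> ?F" by blast
  qed
  then obtain C where CF: "C \<in> ?F" and Cmax: "\<forall>X\<in>?F. C \<subseteq> X \<longrightarrow> X = C"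
    by (rule bexE)
  have C: "convex_cone C" "K \<subseteq> C" "u \<notin> C"
    using CF by simp_all
  have max: "X = C" if "convex_cone X" "C \<subseteq> X" "u \<notin> X" for X
    using Cmax that order_trans[OF C(2) that(2)] by simp
  \<comment> \<open>Adjoining the ray of \<open>y\<close> enlarges the maximal cone
    \<open>C\<close>, so the new cone \<open>D\<close> must contain \<open>u\<close>; the
    coefficient of \<open>y\<close> is nonzero because \<open>u\<close> is not in
    \<open>C\<close>.\<close>
  have adjoin: "\<exists>c\<in>C. \<exists>s>0. u = c + s *\<^sub>R y" if "y \<notin> C" for y
  proof -
    define D where "D = {c + s *\<^sub>R y | c s. c \<in> C \<and> 0 \<le> s}"
    have D_I: "c + s *\<^sub>R y \<in> D" if "c \<in> C" "0 \<le> s" for c s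
      using that unfolding D_def by blast
    have "convex_cone D"
      unfolding convex_cone_iff
    proof (intro conjI ballI allI impI)
      show "0 \<in> D"
        using D_I[of 0 0] convex_cone_contains_0[OF C(1)] by simp
    next
      fix x z assume "x \<in> D" "z \<in> D"
      then obtain c s d t where "c \<in> C" "0 \<le> s" "x = c + s *\<^sub>R y" "d \<in> C" "0 \<le> t" "z = d + t *\<^sub>R y"
        unfolding D_def by blast
      then show "x + z \<in> D"
        using D_I[of "c + d" "s + t"] convex_cone_add[OF C(1)] by (simp add: algebra_simps)
    next
      fix x and a :: real assume "x \<in> D" "0 \<le> a"
      then obtain c s where "c \<in> C" "0 \<le> s" "x = c + s *\<^sub>R y"
        unfolding D_def by blast
      then show "a *\<^sub>R x \<in> D"
        using D_I[of "a *\<^sub>R c" "a * s"] convex_cone_scaleR[OF C(1) \<open>0 \<le> a\<close>] \<open>0 \<le> a\<close>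
        by (simp add: algebra_simps)
    qed
    moreover have "C \<subseteq> D"
      using D_I[of _ 0] by auto
    moreover have "y \<in> D"
      using D_I[of 0 1] convex_cone_contains_0[OF C(1)] by simp
    ultimately have "u \<in> D"
      using max[of D] that by metis
    then obtain c s where cs: "c \<in> C" "s \<ge> 0" "u = c + s *\<^sub>R y"
      unfolding D_def by auto
    moreover have "s \<noteq> 0"
      using cs C(3) by auto
    ultimately show ?thesis
      by (metis order_le_less)
  qed
  have "y \<in> C \<or> - y \<in> C" for y
  proof (rule ccontr)
    assume "\<not> ?thesis"
    then obtain c s c' s' where
      1: "c \<in> C" "s > 0" "u = c + s *\<^sub>R y" and 2: "c' \<in> C" "s' > 0" "u = c' + s' *\<^sub>R (- y)"
      using adjoin by meson
    \<comment> \<open>Weighting the two representations of \<open>u\<close> by \<open>s'\<close> and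
      \<open>s\<close> cancels \<open>y\<close> and puts a positive multiple of \<open>u\<close>
      into \<open>C\<close>.\<close>
    have "(s + s') *\<^sub>R u = s *\<^sub>R (c' + s' *\<^sub>R (- y)) + s' *\<^sub>R (c + s *\<^sub>R y)"
      using 1(3) 2(3) by (metis scaleR_add_left)
    also have "\<dots> = s *\<^sub>R c' + s' *\<^sub>R c"
      by (simp add: algebra_simps)
    finally have "(s + s') *\<^sub>R u \<in> C"
      using C(1) 1 2 by (simp add: convex_cone_add convex_cone_scaleR)
    then show False
      using convex_cone_scaleR[OF C(1), of "inverse (s + s')" "(s + s') *\<^sub>R u"] C(3) 1(2) 2(2)
      by simp
  qed
  with C show ?thesis by blast
qed

text \<open>
  For a convex cone \<open>C\<close> containing every vector or its opposite, the half-line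
  \<open>{t. y - t *\<^sub>R u \<in> C}\<close> determines the value at \<open>y\<close> of the functional.
\<close>

lemma cone_functional:
  fixes K H :: "'a::real_vector set"
  assumes H: "subspace H" and K: "convex_cone K" and u: "u \<in> H" "u \<notin> K"
    and absorb: "\<And>y. y \<in> H \<Longrightarrow> \<exists>t. y - t *\<^sub>R u \<in> K"
  obtains f :: "'a \<Rightarrow> real" where
    "\<And>x y. x \<in> H \<Longrightarrow> y \<in> H \<Longrightarrow> f (x + y) = f x + f y"
    "\<And>c x. x \<in> H \<Longrightarrow> f (c *\<^sub>R x) = c * f x"
    "\<And>x. x \<in> H \<Longrightarrow> x \<in> K \<Longrightarrow> f x \<le> 0" "f u = 1"
proof -
  obtain C where C: "convex_cone C" "K \<subseteq> C" "u \<notin> C" and tot: "\<And>y. y \<in> C \<or> - y \<in> C"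
    using exists_total_convex_cone[OF K u(2)] by blast
  have mu: "- u \<in> C"
    using tot C(3) by blast
  have pos: "t \<le> 0" if "t *\<^sub>R u \<in> C" for t
  proof (rule ccontr)
    assume "\<not> t \<le> 0"
    then show False
      using convex_cone_scaleR[OF C(1) _ that, of "inverse t"] C(3) by simp
  qed
  define S where "S y = {t. y - t *\<^sub>R u \<in> C}" for y
  define f where "f y = Inf (S y)" for y
  \<comment> \<open>Adding the two cone members cancels \<open>y\<close> and leaves a multiple of
    \<open>u\<close>, whose coefficient cannot be positive. So \<open>S (- y)\<close> provides lower
    bounds for \<open>S y\<close>.\<close>
  have low: "- s \<le> t" if "t \<in> S y" "s \<in> S (- y)" for s t y
  proof -
    have "(y - t *\<^sub>R u) + (- y - s *\<^sub>R u) \<in> C"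
      using that C(1) unfolding S_def by (blast intro: convex_cone_add)
    moreover have "(y - t *\<^sub>R u) + (- y - s *\<^sub>R u) = (- t - s) *\<^sub>R u"
      by (simp add: algebra_simps)
    ultimately show ?thesis
      using pos by fastforce
  qed
  have ne: "S y \<noteq> {}" if "y \<in> H" for y
    using absorb[OF that] C(2) unfolding S_def by blast
  have bdd: "bdd_below (S y)" if "y \<in> H" for y
    using low ne[of "- y"] that subspace_neg[OF H] by (meson bdd_belowI ex_in_conv)
  have f_le: "f y \<le> t" if "y \<in> H" "y - t *\<^sub>R u \<in> C" for y t
    unfolding f_def using bdd that by (auto simp: S_def intro: cInf_lower)
  have f_ge: "t \<le> f y" if "y \<in> H" "t *\<^sub>R u - y \<in> C" for y t
  proof -
    have "- y - (- t) *\<^sub>R u = t *\<^sub>R u - y" by simp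
    then have "- t \<in> S (- y)"
      using that(2) unfolding S_def by (metis mem_Collect_eq)
    then show ?thesis
      unfolding f_def using ne[OF that(1)] low by (fastforce intro!: cInf_greatest)
  qed
  \<comment> \<open>Totality of \<open>C\<close> decides membership for \<open>t\<close> strictly
    above or below \<open>f y\<close>, but not at \<open>t = f y\<close>; hence the epsilons in the
    proofs of linearity.\<close>
  have up: "y - t *\<^sub>R u \<in> C" if "y \<in> H" "f y < t" for y t
    using tot[of "y - t *\<^sub>R u"] f_ge[of y t] that by auto
  have dn: "t *\<^sub>R u - y \<in> C" if "y \<in> H" "t < f y" for y t
    using tot[of "y - t *\<^sub>R u"] f_le[of y t] that by auto
  have add: "f (x + y) = f x + f y" if xy: "x \<in> H" "y \<in> H" for x y
  proof (rule antisym)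
    show "f (x + y) \<le> f x + f y"
    proof (rule field_le_epsilon)
      fix e :: real assume "0 < e"
      then have "(x - (f x + e/2) *\<^sub>R u) + (y - (f y + e/2) *\<^sub>R u) \<in> C"
        using xy by (intro convex_cone_add[OF C(1)] up) auto
      moreover have "(x - (f x + e/2) *\<^sub>R u) + (y - (f y + e/2) *\<^sub>R u)
          = (x + y) - ((f x + e/2) + (f y + e/2)) *\<^sub>R u"
        by (simp only: scaleR_add_left) (simp add: algebra_simps)
      ultimately have "f (x + y) \<le> (f x + e/2) + (f y + e/2)"
        using f_le xy subspace_add[OF H] by metis
      then show "f (x + y) \<le> f x + f y + e" by simp
    qed
    show "f x + f y \<le> f (x + y)"
    proof (rule field_le_epsilon)
      fix e :: real assume "0 < e"
      then have "((f x - e/2) *\<^sub>R u - x) + ((f y - e/2) *\<^sub>R u - y) \<in> C"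
        using xy by (intro convex_cone_add[OF C(1)] dn) auto
      moreover have "((f x - e/2) *\<^sub>R u - x) + ((f y - e/2) *\<^sub>R u - y)
          = ((f x - e/2) + (f y - e/2)) *\<^sub>R u - (x + y)"
        by (simp only: scaleR_add_left) (simp add: algebra_simps)
      ultimately have "(f x - e/2) + (f y - e/2) \<le> f (x + y)"
        using f_ge xy subspace_add[OF H] by metis
      then show "f x + f y \<le> f (x + y) + e" by simp
    qed
  qed
  have zero: "f 0 = 0"
    using add[of 0 0] subspace_0[OF H] by simp
  have neg: "f (- x) = - f x" if "x \<in> H" for x
    using add[of x "- x"] that subspace_neg[OF H that] zero by simp
  have scale_le: "f (c *\<^sub>R x) \<le> c * f x" if "x \<in> H" "c > 0" for c x
  proof (rule field_le_epsilon)
    fix e :: real assume "0 < e"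
    \<comment> \<open>The slack \<open>e / c\<close> becomes \<open>e\<close> after scaling by
      \<open>c\<close>.\<close>
    then have "c *\<^sub>R (x - (f x + e / c) *\<^sub>R u) \<in> C"
      using that by (intro convex_cone_scaleR[OF C(1)] up) auto
    moreover have "c *\<^sub>R (x - (f x + e / c) *\<^sub>R u) = c *\<^sub>R x - (c * f x + e) *\<^sub>R u"
      using that by (simp add: algebra_simps)
    ultimately show "f (c *\<^sub>R x) \<le> c * f x + e"
      using f_le that subspace_scale[OF H] by metis
  qed
  have scale_pos: "f (c *\<^sub>R x) = c * f x" if "x \<in> H" "c > 0" for c x
  proof (rule antisym)
    show "f (c *\<^sub>R x) \<le> c * f x"
      by (rule scale_le[OF that])
    show "c * f x \<le> f (c *\<^sub>R x)"
      using scale_le[of "c *\<^sub>R x" "inverse c"] that subspace_scale[OF H that(1), of c]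
      by (simp add: field_simps)
  qed
  show thesis
  proof
    show "f (c *\<^sub>R x) = c * f x" if "x \<in> H" for c x
    proof (cases c "0::real" rule: linorder_cases)
      case less
      then show ?thesis
        using scale_pos[of x "- c"] neg[of "c *\<^sub>R x"] that subspace_scale[OF H that, of c] by simp
    qed (use that zero scale_pos in auto)
    show "f x \<le> 0" if "x \<in> H" "x \<in> K" for x
      using f_le[of x 0] that C(2) by auto
    \<comment> \<open>Both \<open>u - 1 *\<^sub>R u\<close> and its opposite are \<open>0\<close>,
      which lies in \<open>C\<close>.\<close>
    show "f u = 1"
      using f_le[of u 1] f_ge[of u 1] u(1) convex_cone_contains_0[OF C(1)] by auto
  qed (rule add)
qed

section \<open>Topological vector spaces: continuity and separation by continuous
  functionals\<close>

lemma vector_topology_continuous_add: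
  assumes "vector_topology_on H T" "continuous_map S T f" "continuous_map S T g"
  shows "continuous_map S T (\<lambda>x. f x + g x)"
proof -
  have "continuous_map S (prod_topology T T) (\<lambda>x. (f x, g x))"
    using assms by (simp add: continuous_map_pairwise o_def)
  moreover have "continuous_map (prod_topology T T) T (\<lambda>(X, Y). X + Y)"
    using assms(1) by (simp add: vector_topology_on_def)
  ultimately show ?thesis
    using continuous_map_compose by (fastforce simp: o_def)
qed

lemma vector_topology_continuous_scaleR:
  assumes "vector_topology_on H T" "continuous_map S euclideanreal c" "continuous_map S T f"
  shows "continuous_map S T (\<lambda>x. c x *\<^sub>R f x)"
proof -
  have "continuous_map S (prod_topology euclideanreal T) (\<lambda>x. (c x, f x))"
    using assms by (simp add: continuous_map_pairwise o_def)
  moreover have "continuous_map (prod_topology euclideanreal T) T (\<lambda>(c, X). c *\<^sub>R X)"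
    using assms(1) by (simp add: vector_topology_on_def)
  ultimately show ?thesis
    using continuous_map_compose by (fastforce simp: o_def)
qed

text \<open>The map sending \<open>s\<close> to \<open>X + s *\<^sub>R Y\<close> is continuous, so
  the preimage of \<open>U\<close> is an open set of reals around \<open>0\<close>.\<close>

lemma vector_topology_absorbing:
  assumes T: "vector_topology_on H T" and U: "openin T U" "X \<in> U" and Y: "Y \<in> H"
  obtains e where "e > 0" "X + e *\<^sub>R Y \<in> U"
proof -
  have top: "topspace T = H"
    using T by (simp add: vector_topology_on_def)
  then have "X \<in> topspace T"
    using U openin_subset by blast
  then have "continuous_map euclideanreal T (\<lambda>s. X + s *\<^sub>R Y)"
    using Y top
    by (intro vector_topology_continuous_add[OF T] vector_topology_continuous_scaleR[OF T]) auto
  then have "open {s. X + s *\<^sub>R Y \<in> U}"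
    using openin_continuous_map_preimage[OF _ U(1)] by fastforce
  moreover have "0 \<in> {s. X + s *\<^sub>R Y \<in> U}"
    using U(2) by simp
  ultimately obtain e where "e > 0" "ball 0 e \<subseteq> {s. X + s *\<^sub>R Y \<in> U}"
    using openE by blast
  then have "X + (e / 2) *\<^sub>R Y \<in> U"
    by (auto simp: subset_iff)
  with \<open>e > 0\<close> show thesis
    using that half_gt_zero by blast
qed

text \<open>
  Scaling a translate of \<open>U\<close> by \<open>e\<close> in both directions traps the increments of \<open>f\<close> between \<open>- e\<close> and \<open>e\<close>.
\<close>

lemma linear_positive_on_open_imp_continuous:
  assumes T: "vector_topology_on H T" and U: "openin T U" "u \<in> U" and H: "subspace H"
    and add: "\<And>X Y. X \<in> H \<Longrightarrow> Y \<in> H \<Longrightarrow> f (X + Y) = f X + f Y"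
    and scale: "\<And>c X. X \<in> H \<Longrightarrow> f (c *\<^sub>R X) = c * f X"
    and u: "f u = (1::real)" and pos: "\<And>X. X \<in> U \<Longrightarrow> f X > 0"
  shows "continuous_map T euclideanreal f"
  unfolding continuous_map_eq_topcontinuous_at topcontinuous_at_def
proof (intro ballI conjI allI impI)
  have top: "topspace T = H"
    using T by (simp add: vector_topology_on_def)
  have uH: "u \<in> H"
    using U openin_subset top by blast
  fix X V assume X: "X \<in> topspace T" and "openin euclideanreal V \<and> f X \<in> V"
  then obtain e where e: "e > 0" "ball (f X) e \<subseteq> V"
    using openE by (metis open_openin)
  \<comment> \<open>\<open>X\<close> is subtracted by scaling with \<open>- 1\<close>, so continuity
    of addition and scaling is enough. At \<open>Y = X\<close> the map takes the value
    \<open>u\<close>, a point of \<open>U\<close>.\<close>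
  let ?g = "\<lambda>c Y. u + c *\<^sub>R (Y + (- 1) *\<^sub>R X)"
  have cont: "continuous_map T T (?g c)" for c
    using X uH top
    by (intro vector_topology_continuous_add[OF T] vector_topology_continuous_scaleR[OF T]) auto
  let ?W = "{Y \<in> topspace T. ?g (1 / e) Y \<in> U} \<inter> {Y \<in> topspace T. ?g (- 1 / e) Y \<in> U}"
  have "openin T ?W"
    using openin_continuous_map_preimage[OF cont U(1)] by (intro openin_Int)
  moreover have "X \<in> ?W"
    using X U(2) by simp
  moreover have "f Y \<in> V" if "Y \<in> ?W" for Y
  proof -
    have YX: "Y \<in> H" "X \<in> H"
      using that X top by auto
    have "f (?g c Y) = 1 + c * (f Y - f X)" for c
      using YX uH u H by (simp add: add scale subspace_add subspace_scale subspace_neg algebra_simps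
          del: scaleR_minus_left scaleR_minus1_left)
    then have "1 + (1 / e) * (f Y - f X) > 0" "1 + (- 1 / e) * (f Y - f X) > 0"
      using that pos by (metis (no_types, lifting) IntD1 mem_Collect_eq, metis (no_types, lifting) IntD2 mem_Collect_eq)
    then have "\<bar>f Y - f X\<bar> < e"
      using e(1) by (auto simp: field_simps abs_less_iff)
    then show ?thesis
      using e(2) by (auto simp: dist_real_def abs_minus_commute)
  qed
  ultimately show "\<exists>W. openin T W \<and> X \<in> W \<and> (\<forall>Y\<in>W. f Y \<in> V)"
    by blast
qed simp_all

text \<open>
  The functional is obtained from the convex cone \<open>K - cone V\<close>, which absorbs \<open>H\<close> along \<open>- u\<close>.
\<close>

lemma separate_cone_convex:
  fixes K V :: "'w claim set"
  assumes T: "vector_topology_on H T" and H: "subspace H" and K: "convex_cone K"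
    and V: "convex V" "K \<inter> V = {}" and U: "openin T U" "u \<in> U" "U \<subseteq> V"
  obtains f where "f \<in> topological_dual H T"
    "\<And>X. X \<in> H \<Longrightarrow> X \<in> K \<Longrightarrow> f X \<le> 0" "\<And>X. X \<in> U \<Longrightarrow> f X > 0"
proof -
  have top: "topspace T = H"
    using T by (simp add: vector_topology_on_def)
  have UH: "U \<subseteq> H"
    using U openin_subset top by blast
  define N where "N = conic hull V"
  have N: "convex_cone N"
    using V(1) U unfolding N_def convex_cone_def
    by (auto simp: convex_conic_hull conic_conic_hull conic_hull_eq_empty)
  have N_I: "t *\<^sub>R v \<in> N" if "v \<in> V" "0 \<le> t" for t v
    using that unfolding N_def conic_hull_explicit by blast
  define K' where "K' = {k - n | k n. k \<in> K \<and> n \<in> N}"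
  have K'_I: "k - n \<in> K'" if "k \<in> K" "n \<in> N" for k n
    using that unfolding K'_def by blast
  have K'_E: "\<exists>k n. k \<in> K \<and> n \<in> N \<and> x = k - n" if "x \<in> K'" for x
    using that unfolding K'_def by blast
  have K': "convex_cone K'"
    unfolding convex_cone_iff
  proof (intro conjI ballI allI impI)
    show "0 \<in> K'"
      using K'_I[of 0 0] convex_cone_contains_0 K N by fastforce
  next
    fix x y assume "x \<in> K'" "y \<in> K'"
    then obtain k n l m where *: "k \<in> K" "n \<in> N" "x = k - n" "l \<in> K" "m \<in> N" "y = l - m"
      using K'_E by blast
    then have "(k + l) - (n + m) \<in> K'"
      using K N by (intro K'_I convex_cone_add)
    moreover have "x + y = (k + l) - (n + m)"
      by (simp add: *(3,6) algebra_simps)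
    ultimately show "x + y \<in> K'" by simp
  next
    fix x and c :: real assume "x \<in> K'" "0 \<le> c"
    then obtain k n where "k \<in> K" "n \<in> N" "x = k - n"
      using K'_E by blast
    then show "c *\<^sub>R x \<in> K'"
      using K'_I[of "c *\<^sub>R k" "c *\<^sub>R n"] K N \<open>0 \<le> c\<close>
      by (simp add: convex_cone_scaleR scaleR_diff_right)
  qed
  \<comment> \<open>If \<open>u = k - t *\<^sub>R v\<close>, dividing \<open>k\<close> by
    \<open>1 + t\<close> gives a convex combination of \<open>u\<close> and \<open>v\<close>, hence
    a common point of \<open>K\<close> and \<open>V\<close>.\<close>
  have "u \<notin> K'"
  proof
    assume "u \<in> K'"
    then obtain k n where "k \<in> K" "n \<in> N" "u = k - n"
      using K'_E by blast
    moreover then obtain t v where tv: "0 \<le> t" "v \<in> V" "n = t *\<^sub>R v"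
      unfolding N_def conic_hull_explicit by blast
    ultimately have k: "k \<in> K" "k = u + t *\<^sub>R v"
      by simp_all
    have "(1 / (1 + t)) *\<^sub>R k \<in> K"
      using k K tv by (intro convex_cone_scaleR) auto
    moreover have "(1 / (1 + t)) *\<^sub>R u + (t / (1 + t)) *\<^sub>R v \<in> V"
      using tv U by (intro convexD[OF V(1)]) (auto simp: field_simps)
    moreover have "(1 / (1 + t)) *\<^sub>R k = (1 / (1 + t)) *\<^sub>R u + (t / (1 + t)) *\<^sub>R v"
      unfolding k(2) by (simp add: scaleR_add_right)
    ultimately show False
      using V(2) by auto
  qed
  moreover have "\<exists>t. Y - t *\<^sub>R u \<in> K'" if Y: "Y \<in> H" for Y
  proof -
    obtain e where e: "e > 0" "u + e *\<^sub>R (- Y) \<in> U"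
      using vector_topology_absorbing[OF T U(1,2), of "- Y"] subspace_neg[OF H Y] by blast
    \<comment> \<open>The point \<open>u - e *\<^sub>R Y\<close> of \<open>V\<close>, scaled by
      \<open>1 / e\<close>, lies in \<open>N\<close>, and its opposite is
      \<open>Y - (1 / e) *\<^sub>R u\<close>.\<close>
    then have "0 - (1 / e) *\<^sub>R (u + e *\<^sub>R (- Y)) \<in> K'"
      using U(3) K convex_cone_contains_0 by (intro K'_I N_I) auto
    moreover have "0 - (1 / e) *\<^sub>R (u + e *\<^sub>R (- Y)) = Y - (1 / e) *\<^sub>R u"
      using e(1) by (simp add: algebra_simps)
    ultimately show ?thesis by metis
  qed
  ultimately obtain f :: "'w claim \<Rightarrow> real" where
    f_add: "\<And>X Y. X \<in> H \<Longrightarrow> Y \<in> H \<Longrightarrow> f (X + Y) = f X + f Y" and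
    f_scale: "\<And>c X. X \<in> H \<Longrightarrow> f (c *\<^sub>R X) = c * f X" and
    f_le: "\<And>X. X \<in> H \<Longrightarrow> X \<in> K' \<Longrightarrow> f X \<le> 0" and fu: "f u = 1"
    using cone_functional[OF H K', of u] U UH by blast
  have f_nonneg: "0 \<le> f X" if "X \<in> U" for X
  proof -
    have XH: "X \<in> H"
      using that UH by blast
    have "0 - 1 *\<^sub>R X \<in> K'"
      using that U(3) K convex_cone_contains_0 by (intro K'_I N_I) auto
    then have "f ((- 1) *\<^sub>R X) \<le> 0"
      using subspace_neg[OF H XH] by (intro f_le) simp_all
    then show ?thesis
      using f_scale[OF XH, of "- 1"] by simp
  qed
  \<comment> \<open>Openness makes the inequality strict: a small move along \<open>- u\<close>
    stays in \<open>U\<close> and lowers \<open>f\<close> by \<open>e\<close>.\<close>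
  have f_pos: "f X > 0" if X: "X \<in> U" for X
  proof -
    have uH: "u \<in> H" "X \<in> H"
      using U X UH by auto
    obtain e where e: "e > 0" "X + e *\<^sub>R ((- 1) *\<^sub>R u) \<in> U"
      using vector_topology_absorbing[OF T U(1) X, of "(- 1) *\<^sub>R u"] subspace_scale[OF H uH(1)] by blast
    have "f (X + e *\<^sub>R ((- 1) *\<^sub>R u)) = f X - e"
      using f_add[OF uH(2), of "(- e) *\<^sub>R u"] f_scale[OF uH(1), of "- e"] subspace_scale[OF H uH(1), of "- e"] fu
      by simp
    then show ?thesis
      using f_nonneg[OF e(2)] e(1) by simp
  qed
  have "continuous_map T euclideanreal f"
    using linear_positive_on_open_imp_continuous[OF T U(1,2) H f_add f_scale fu f_pos] .
  \<comment> \<open>Members of the dual are \<open>undefined\<close> outside \<open>H\<close>;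
    restricting to the carrier of \<open>T\<close> preserves continuity.\<close>
  then have "continuous_map T euclideanreal (restrict f H)"
    using top by (metis continuous_map_eq restrict_apply')
  then have "restrict f H \<in> topological_dual H T"
    using H by (simp add: topological_dual_def f_add f_scale subspace_add subspace_scale)
  moreover have "X \<in> K'" if "X \<in> K" for X
    using K'_I[OF that, of 0] convex_cone_contains_0[OF N] by simp
  ultimately show thesis
    using f_le f_pos UH by (intro that[of "restrict f H"]) (auto simp: subset_iff)
qed

text \<open>Turns lower semi-continuity, which is stated with sequences, into closedness of sublevel
  sets.\<close>

lemma metrizable_sequentially_closed:
  assumes T: "metrizable_space T" and S: "S \<subseteq> topspace T"
    and seq: "\<And>\<sigma> l. range \<sigma> \<subseteq> S \<Longrightarrow> limitin T \<sigma> l sequentially \<Longrightarrow> l \<in> S"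
  shows "closedin T S"
proof -
  obtain M d where "Metric_space M d" "T = Metric_space.mtopology M d"
    using T unfolding metrizable_space_def by blast
  then show ?thesis
    using Metric_space.metric_closedin_iff_sequentially_closed Metric_space.topspace_mtopology S seq
    by metis
qed

section \<open>Order structure of the market, pricing functionals and their normalisation\<close>

context financial_market
begin

lemma H_add: "X \<in> H \<Longrightarrow> Y \<in> H \<Longrightarrow> X + Y \<in> H"
  using H_subspace by (rule subspace_add)

lemma H_scaleR: "X \<in> H \<Longrightarrow> c *\<^sub>R X \<in> H"
  using H_subspace by (rule subspace_scale)

lemma H_0: "0 \<in> H"
  using H_subspace by (rule subspace_0)

lemma topspace_T: "topspace T = H"
  using T_vector by (simp add: vector_topology_on_def)

lemma claim_le_trans: "X \<in> H \<Longrightarrow> Y \<in> H \<Longrightarrow> Z \<in> H \<Longrightarrow> le X Y \<Longrightarrow> le Y Z \<Longrightarrow> le X Z"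
  using le_vector transp_onD[of H le X Y Z] by (simp add: vector_preorder_on_def)

lemma claim_le_refl: "X \<in> H \<Longrightarrow> le X X"
  using le_vector reflp_onD[of H le X] by (simp add: vector_preorder_on_def)

lemma claim_le_add_right: "X \<in> H \<Longrightarrow> Y \<in> H \<Longrightarrow> Z \<in> H \<Longrightarrow> le X Y \<Longrightarrow> le (X + Z) (Y + Z)"
  using le_vector unfolding vector_preorder_on_def by blast

lemma claim_le_scaleR: "X \<in> H \<Longrightarrow> Y \<in> H \<Longrightarrow> 0 \<le> c \<Longrightarrow> le X Y \<Longrightarrow> le (c *\<^sub>R X) (c *\<^sub>R Y)"
  using le_vector unfolding vector_preorder_on_def by blast

lemma claim_le_add_mono:
  assumes "X \<in> H" "Y \<in> H" "Z \<in> H" "W \<in> H" "le X Y" "le Z W"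
  shows "le (X + Z) (Y + W)"
proof -
  have "le (X + Z) (Y + Z)" "le (Z + Y) (W + Y)"
    using assms by (auto intro: claim_le_add_right)
  then show ?thesis
    using assms claim_le_trans[of "X + Z" "Y + Z" "Y + W"] by (simp add: H_add add.commute)
qed

lemma R_H: "R \<subseteq> H"
  using R_pos by (auto simp: pos_claims_def)

text \<open>Martingale functionals before normalisation at \<open>1\<close>: they are closed under
  nonnegative combinations, and separation yields them before it is known whether constants are
  charged.\<close>

definition pricing_functionals :: "('w claim \<Rightarrow> real) set" where
  "pricing_functionals = {\<phi> \<in> positive_dual H T le. \<forall>l\<in>I. \<phi> l \<le> 0}"

lemma pricing_functionalsD:
  assumes "\<phi> \<in> pricing_functionals"
  shows "X \<in> H \<Longrightarrow> Y \<in> H \<Longrightarrow> \<phi> (X + Y) = \<phi> X + \<phi> Y"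
    and "X \<in> H \<Longrightarrow> \<phi> (c *\<^sub>R X) = c * \<phi> X"
    and "continuous_map T euclideanreal \<phi>"
    and "X \<in> H \<Longrightarrow> le 0 X \<Longrightarrow> 0 \<le> \<phi> X"
    and "l \<in> I \<Longrightarrow> \<phi> l \<le> 0"
  using assms
  unfolding pricing_functionals_def positive_dual_def topological_dual_def nonneg_claims_def
  by simp_all

lemma pricing_functionals_mono:
  assumes \<phi>: "\<phi> \<in> pricing_functionals" and XY: "X \<in> H" "Y \<in> H" "le X Y"
  shows "\<phi> X \<le> \<phi> Y"
proof -
  let ?Z = "(- 1) *\<^sub>R X"
  have Z: "?Z \<in> H"
    using XY(1) by (rule H_scaleR)
  have "le 0 (Y + ?Z)"
    using claim_le_add_right[OF XY(1,2) Z XY(3)] by simp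
  then have "0 \<le> \<phi> (Y + ?Z)"
    using XY Z by (intro pricing_functionalsD(4)[OF \<phi>] H_add)
  then show ?thesis
    using pricing_functionalsD(1)[OF \<phi> XY(2) Z] pricing_functionalsD(2)[OF \<phi> XY(1), of "- 1"] by simp
qed

lemma pricing_functionals_lincomb:
  assumes "\<phi> \<in> pricing_functionals" "\<psi> \<in> pricing_functionals" "0 \<le> a" "0 \<le> b"
  shows "restrict (\<lambda>X. a * \<phi> X + b * \<psi> X) H \<in> pricing_functionals"
proof -
  have "continuous_map T euclideanreal (\<lambda>X. a * \<phi> X + b * \<psi> X)"
    using assms by (intro continuous_intros pricing_functionalsD(3)) auto
  then have "continuous_map T euclideanreal (restrict (\<lambda>X. a * \<phi> X + b * \<psi> X) H)"
    using topspace_T by (metis (mono_tags, lifting) continuous_map_eq restrict_apply')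
  moreover have "a * \<phi> (X + Y) + b * \<psi> (X + Y) = (a * \<phi> X + b * \<psi> X) + (a * \<phi> Y + b * \<psi> Y)"
    if "X \<in> H" "Y \<in> H" for X Y
    using that by (simp add: pricing_functionalsD(1)[OF assms(1)] pricing_functionalsD(1)[OF assms(2)]
        algebra_simps)
  moreover have "a * \<phi> (c *\<^sub>R X) + b * \<psi> (c *\<^sub>R X) = c * (a * \<phi> X + b * \<psi> X)" if "X \<in> H" for X c
    using that by (simp add: pricing_functionalsD(2)[OF assms(1)] pricing_functionalsD(2)[OF assms(2)]
        algebra_simps)
  ultimately have "restrict (\<lambda>X. a * \<phi> X + b * \<psi> X) H \<in> topological_dual H T"
    unfolding topological_dual_def by (simp add: H_add H_scaleR)
  moreover have "0 \<le> a * \<phi> X + b * \<psi> X" if "X \<in> H" "le 0 X" for X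
    using that assms by (simp add: pricing_functionalsD(4))
  moreover have "l \<in> H \<and> a * \<phi> l + b * \<psi> l \<le> 0" if "l \<in> I" for l
    using that assms I_H pricing_functionalsD(5)[OF assms(1) that] pricing_functionalsD(5)[OF assms(2) that]
    by (auto intro!: add_nonpos_nonpos mult_nonneg_nonpos)
  ultimately show ?thesis
    by (simp add: pricing_functionals_def positive_dual_def nonneg_claims_def)
qed

text \<open>A negligible claim lies both above and below \<open>0\<close>, so a monotone functional
  sends it to \<open>\<phi> 0 = 0\<close>; this gives absolute continuity.\<close>

lemma pricing_functional_in_Q_ac:
  assumes "\<phi> \<in> pricing_functionals" "\<phi> (const_claim 1) = 1"
  shows "\<phi> \<in> Q_ac H T le I"
proof -
  have "\<phi> Z = 0" if "Z \<in> negligible_claims H le" for Z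
  proof -
    have "\<phi> 0 = 0"
      using pricing_functionalsD(2)[OF assms(1) H_0, of 0] by simp
    then show ?thesis
      using pricing_functionals_mono[OF assms(1), of 0 Z] pricing_functionals_mono[OF assms(1), of Z 0]
        that H_0 by (auto simp: negligible_claims_def)
  qed
  then show ?thesis
    using assms by (simp add: Q_ac_def martingale_functionals_def pricing_functionals_def)
qed

lemma Q_ac_pricing: "\<phi> \<in> Q_ac H T le I \<Longrightarrow> \<phi> \<in> pricing_functionals"
  by (simp add: Q_ac_def martingale_functionals_def pricing_functionals_def)

lemma Q_ac_const:
  assumes "\<phi> \<in> Q_ac H T le I"
  shows "\<phi> (const_claim c) = c"
proof -
  have "const_claim c = c *\<^sub>R const_claim 1"
    by (simp add: const_claim_def scaleR_fun_def)
  moreover have "\<phi> (c *\<^sub>R const_claim 1) = c"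
    using assms pricing_functionalsD(2)[OF Q_ac_pricing[OF assms] H_const]
    by (simp add: Q_ac_def martingale_functionals_def)
  ultimately show ?thesis by metis
qed

text \<open>
  The separating functional \<open>\<phi>\<close> may vanish on constants; adding a small multiple of \<open>\<psi>\<close>
  makes it normalisable without losing the strict inequality.
\<close>

lemma Q_ac_separation:
  assumes \<phi>: "\<phi> \<in> pricing_functionals" and \<psi>: "\<psi> \<in> pricing_functionals"
    and X: "X \<in> H" "r * \<phi> (const_claim 1) < \<phi> X" and one: "0 < \<psi> (const_claim 1)"
  shows "\<exists>q\<in>Q_ac H T le I. r < q X"
proof -
  let ?d = "\<phi> X - r * \<phi> (const_claim 1)" and ?e = "\<psi> X - r * \<psi> (const_claim 1)"
  have "\<exists>b>0. d + b * e > 0" if "d > 0" for d e :: real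
  proof (intro exI conjI)
    \<comment> \<open>With this weight the perturbed value is
      \<open>d * (1 + \<bar>e\<bar> + e) / (1 + \<bar>e\<bar>)\<close>, which is positive whatever
      the sign of \<open>e\<close>.\<close>
    show "d / (1 + \<bar>e\<bar>) > 0"
      using that by (intro divide_pos_pos) auto
    have "d * (1 + \<bar>e\<bar> + e) > 0"
      using that by (intro mult_pos_pos) auto
    moreover have "d + d / (1 + \<bar>e\<bar>) * e = d * (1 + \<bar>e\<bar> + e) / (1 + \<bar>e\<bar>)"
      using abs_ge_zero[of e] by (simp add: field_simps)
    ultimately show "d + d / (1 + \<bar>e\<bar>) * e > 0"
      by (simp add: add_pos_nonneg)
  qed
  from this[of ?d ?e] X(2) have "\<exists>b>0. ?d + b * ?e > 0"
    by simp
  then obtain b where b: "b > 0" "?d + b * ?e > 0"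
    by blast
  \<comment> \<open>The value at \<open>1\<close> of the combination of \<open>\<phi>\<close> and
    \<open>b\<close> times \<open>\<psi>\<close>. Dividing by it normalises, and
    \<open>r < q X\<close> becomes \<open>?d + b * ?e > 0\<close>.\<close>
  define c where "c = \<phi> (const_claim 1) + b * \<psi> (const_claim 1)"
  have "0 \<le> \<phi> (const_claim 1)"
    using H_const by (intro pricing_functionalsD(4)[OF \<phi>] le_pointwise H_0) (auto simp: const_claim_def)
  then have c: "c > 0"
    unfolding c_def using b(1) one by (simp add: add_nonneg_pos)
  define q where "q = restrict (\<lambda>Y. (1 / c) * \<phi> Y + (b / c) * \<psi> Y) H"
  have "q \<in> pricing_functionals"
    unfolding q_def using \<phi> \<psi> b(1) c by (intro pricing_functionals_lincomb) auto
  moreover have "q (const_claim 1) = 1"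
    using c by (simp add: q_def H_const flip: add_divide_distrib) (simp add: c_def)
  ultimately have "q \<in> Q_ac H T le I"
    by (rule pricing_functional_in_Q_ac)
  moreover have "r < q X"
    using X(1) b(2) c by (simp add: q_def field_simps) (simp add: c_def algebra_simps)
  ultimately show ?thesis by blast
qed

text \<open>A functional that is nonpositive on \<open>K\<close> is positive, because
  \<open>K\<close> contains the claims below \<open>0\<close>, and nonpositive on net trades. Two
  sets \<open>U\<close> and \<open>V\<close> appear because local convexity provides only an open
  set inside a convex one; for an agent they coincide.\<close>

lemma separation_pricing_functional:
  assumes K: "convex_cone K" "I \<subseteq> K" "\<And>X. X \<in> H \<Longrightarrow> le X 0 \<Longrightarrow> X \<in> K"
    and V: "convex V" "K \<inter> V = {}" and U: "openin T U" "X \<in> U" "U \<subseteq> V"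
  shows "\<exists>\<phi>\<in>pricing_functionals. 0 < \<phi> X"
proof -
  obtain \<phi> where \<phi>: "\<phi> \<in> topological_dual H T" "\<And>Y. Y \<in> H \<Longrightarrow> Y \<in> K \<Longrightarrow> \<phi> Y \<le> 0" "\<phi> X > 0"
    using separate_cone_convex[OF T_vector H_subspace K(1) V U] U(2) by metis
  have "0 \<le> \<phi> Y" if Y: "Y \<in> H" "le 0 Y" for Y
  proof -
    have Z: "(- 1) *\<^sub>R Y \<in> H"
      using Y(1) by (rule H_scaleR)
    have "le ((- 1) *\<^sub>R Y) 0"
      using claim_le_add_right[OF H_0 Y(1) Z Y(2)] by simp
    then have "\<phi> ((- 1) *\<^sub>R Y) \<le> 0"
      using Z by (intro \<phi>(2) K(3))
    moreover have "\<phi> ((- 1) *\<^sub>R Y) = (- 1) * \<phi> Y"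
      using \<phi>(1) Y(1) unfolding topological_dual_def by blast
    ultimately show ?thesis by simp
  qed
  then have "\<phi> \<in> pricing_functionals"
    using \<phi> K(2) I_H by (auto simp: pricing_functionals_def positive_dual_def nonneg_claims_def)
  with \<phi>(3) show ?thesis by blast
qed

section \<open>Functionals obtained from agents and from expectations\<close>

lemma agent_pricing_functional:
  assumes p: "p \<in> agents H T le" and p_I: "\<forall>l\<in>I. p l 0" and X: "X \<in> H" "strict_pref p 0 X"
  shows "\<exists>\<phi>\<in>pricing_functionals. 0 < \<phi> X"
proof -
  have tot: "\<And>X Y. X \<in> H \<Longrightarrow> Y \<in> H \<Longrightarrow> p X Y \<or> p Y X"
    and trans: "\<And>X Y Z. X \<in> H \<Longrightarrow> Y \<in> H \<Longrightarrow> Z \<in> H \<Longrightarrow> p X Y \<Longrightarrow> p Y Z \<Longrightarrow> p X Z"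
    and mono: "\<And>X Y. X \<in> H \<Longrightarrow> Y \<in> H \<Longrightarrow> le X Y \<Longrightarrow> p X Y"
    and conv: "\<And>X. X \<in> H \<Longrightarrow> convex {Z \<in> H. p X Z}"
    and lsc: "\<And>Xs X Y. Y \<in> H \<Longrightarrow> range Xs \<subseteq> H \<Longrightarrow> limitin T Xs X sequentially \<Longrightarrow>
      (\<And>n. p (Xs n) Y) \<Longrightarrow> p X Y"
    using p unfolding agents_def mem_Collect_eq transp_on_def by (meson, meson, meson, meson, meson)
  let ?V = "{Z \<in> H. \<not> p Z 0}"
  let ?K = "{Y \<in> H. \<exists>l\<in>I. le Y l}"
  have "closedin T {Z \<in> H. p Z 0}"
  proof (rule metrizable_sequentially_closed[OF T_metrizable])
    show "{Z \<in> H. p Z 0} \<subseteq> topspace T"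
      using topspace_T by blast
    fix \<sigma> l assume "range \<sigma> \<subseteq> {Z \<in> H. p Z 0}" "limitin T \<sigma> l sequentially"
    then show "l \<in> {Z \<in> H. p Z 0}"
      using lsc[OF H_0, of \<sigma> l] limitin_topspace[of T \<sigma> l] topspace_T by blast
  qed
  then have "openin T (H - {Z \<in> H. p Z 0})"
    unfolding closedin_def topspace_T by (rule conjunct2)
  moreover have "H - {Z \<in> H. p Z 0} = ?V"
    by blast
  ultimately have V_open: "openin T ?V"
    by (rule subst[rotated])
  have V_conv: "convex ?V"
  proof (rule convexI)
    \<comment> \<open>The combination is at least as good as \<open>Y\<close>, the less preferred of
      the two points, by convexity of the upper set of \<open>Y\<close>; transitivity then keeps it
      strictly better than \<open>0\<close>.\<close>
    have step: "u *\<^sub>R Y + v *\<^sub>R Z \<in> ?V"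
      if "Y \<in> ?V" "Z \<in> ?V" "0 \<le> u" "0 \<le> v" "u + v = 1" "p Y Z" for Y Z and u v :: real
    proof -
      have "Y \<in> {Z \<in> H. p Y Z}" "Z \<in> {Z \<in> H. p Y Z}"
        using that tot by auto
      then have "u *\<^sub>R Y + v *\<^sub>R Z \<in> {Z \<in> H. p Y Z}"
        using that conv[of Y] by (intro convexD) auto
      then show ?thesis
        using that(1) trans[of Y "u *\<^sub>R Y + v *\<^sub>R Z" 0] H_0 by auto
    qed
    fix Y Z and u v :: real assume *: "Y \<in> ?V" "Z \<in> ?V" "0 \<le> u" "0 \<le> v" "u + v = 1"
    show "u *\<^sub>R Y + v *\<^sub>R Z \<in> ?V"
    proof (cases "p Y Z")
      case True
      then show ?thesis using step[of Y Z u v] * by simp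
    next
      case False
      then have "p Z Y" using tot * by blast
      then show ?thesis using step[of Z Y v u] * by (simp add: add.commute)
    qed
  qed
  have K: "convex_cone ?K"
    unfolding convex_cone_iff
  proof (intro conjI ballI allI impI)
    show "0 \<in> ?K"
      using H_0 I_zero claim_le_refl by blast
  next
    fix Y Z assume "Y \<in> ?K" "Z \<in> ?K"
    then obtain l m where *: "Y \<in> H" "Z \<in> H" "l \<in> I" "m \<in> I" "le Y l" "le Z m"
      by blast
    then have "le (Y + Z) (l + m)"
      using I_H by (intro claim_le_add_mono) auto
    then show "Y + Z \<in> ?K"
      using * convex_cone_add[OF I_cone] H_add by blast
  next
    fix Y and c :: real assume "Y \<in> ?K" "0 \<le> c"
    then obtain l where *: "Y \<in> H" "l \<in> I" "le Y l"
      by blast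
    then have "le (c *\<^sub>R Y) (c *\<^sub>R l)"
      using I_H \<open>0 \<le> c\<close> by (intro claim_le_scaleR) auto
    then show "c *\<^sub>R Y \<in> ?K"
      using * convex_cone_scaleR[OF I_cone \<open>0 \<le> c\<close>] H_scaleR by blast
  qed
  have disj: "?K \<inter> ?V = {}"
    using mono trans p_I I_H H_0 by blast
  show ?thesis
  proof (rule separation_pricing_functional[OF K _ _ V_conv disj V_open _ subset_refl])
    show "I \<subseteq> ?K"
      using I_H claim_le_refl by blast
    show "Y \<in> ?K" if "Y \<in> H" "le Y 0" for Y
      using that I_zero by blast
    show "X \<in> ?V"
      using X by (simp add: strict_pref_def)
  qed
qed

text \<open>Two functionals are combined: one charges \<open>X\<close>, the other charges the
  relevant claim \<open>1\<close> and makes normalisation possible.\<close>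

lemma viable_imp_Q_ac_positive:
  assumes "viable H T le I R" "X \<in> R"
  shows "\<exists>q\<in>Q_ac H T le I. 0 < q X"
proof -
  have *: "\<exists>\<phi>\<in>pricing_functionals. 0 < \<phi> Y" if "Y \<in> R" for Y
    using assms(1) that R_H agent_pricing_functional unfolding viable_def by blast
  obtain \<phi> \<psi> where "\<phi> \<in> pricing_functionals" "0 < \<phi> X" "\<psi> \<in> pricing_functionals" "0 < \<psi> (const_claim 1)"
    using *[OF assms(2)] *[OF R_const[of 1]] by auto
  then show ?thesis
    using Q_ac_separation[of \<phi> \<psi> X 0] assms(2) R_H by auto
qed

text \<open>Taking \<open>r = 0\<close> on relevant claims gives viability from full support;
  arbitrary real \<open>r\<close> below \<open>E X\<close> gives maximality, also when
  \<open>E X\<close> is infinite.\<close>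

lemma lsc_martingale_expectation_le_Q_ac:
  assumes E: "lsc_martingale_expectation H T le I R E" and lc: "locally_convex_topology T"
    and X: "X \<in> H" and r: "ereal r < E X"
  shows "\<exists>q\<in>Q_ac H T le I. r < q X"
proof -
  have lsc: "lower_semicontinuous H T E" and sub: "sublinear_expectation H le E"
    and mart: "\<And>l. l \<in> I \<Longrightarrow> E l \<le> 0"
    using E unfolding lsc_martingale_expectation_def martingale_property_def by blast+
  have E_mono: "\<And>X Y. X \<in> H \<Longrightarrow> Y \<in> H \<Longrightarrow> le X Y \<Longrightarrow> E X \<le> E Y"
    and E_const: "\<And>X c. X \<in> H \<Longrightarrow> E (X + const_claim c) = E X + ereal c"
    and E_add: "\<And>X Y. X \<in> H \<Longrightarrow> Y \<in> H \<Longrightarrow> E (X + Y) \<le> E X + E Y"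
    and E_scale: "\<And>X c. X \<in> H \<Longrightarrow> c > 0 \<Longrightarrow> E (c *\<^sub>R X) = ereal c * E X"
    and E_minf: "E 0 \<noteq> - \<infinity>"
    using sub H_0 unfolding sublinear_expectation_def by blast+
  \<comment> \<open>Homogeneity with factor \<open>2\<close> leaves only \<open>0\<close> and
    infinite values; the martingale property at the net trade \<open>0\<close> excludes
    \<open>\<infinity>\<close>.\<close>
  have E_0: "E 0 = 0"
    using E_scale[OF H_0, of 2] mart[OF I_zero] E_minf by (cases "E 0") auto
  let ?K = "{Y \<in> H. E Y \<le> 0}"
  have K: "convex_cone ?K"
    unfolding convex_cone_iff
  proof (intro conjI ballI allI impI)
    show "0 \<in> ?K"
      using H_0 E_0 by simp
  next
    fix Y Z assume *: "Y \<in> ?K" "Z \<in> ?K"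
    then have "E (Y + Z) \<le> E Y + E Z"
      using E_add by blast
    also have "\<dots> \<le> 0 + 0"
      using * by (intro add_mono) auto
    finally show "Y + Z \<in> ?K"
      using * H_add by simp
  next
    fix Y and c :: real assume *: "Y \<in> ?K" "0 \<le> c"
    show "c *\<^sub>R Y \<in> ?K"
    proof (cases "c = 0")
      case True
      then show ?thesis using H_0 E_0 by simp
    next
      case False
      then have "E (c *\<^sub>R Y) = ereal c * E Y"
        using * E_scale by simp
      then show ?thesis
        using * H_scaleR by (cases "E Y") (auto simp: mult_nonneg_nonpos)
    qed
  qed
  have K_le: "Y \<in> ?K" if "Y \<in> H" "le Y 0" for Y
    using that E_mono[OF _ H_0] E_0 by fastforce
  have K_I: "I \<subseteq> ?K"
    using I_H mart by blast
  have "closedin T ?K"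
  proof (rule metrizable_sequentially_closed[OF T_metrizable])
    show "?K \<subseteq> topspace T"
      using topspace_T by blast
    fix \<sigma> l assume *: "range \<sigma> \<subseteq> ?K" "limitin T \<sigma> l sequentially"
    then have "E l \<le> liminf (\<lambda>n. E (\<sigma> n))"
      using lsc unfolding lower_semicontinuous_def by blast
    also have "\<dots> \<le> liminf (\<lambda>n. 0)"
      using *(1) by (intro Liminf_mono always_eventually) blast
    also have "\<dots> = 0"
      by (simp add: Liminf_const)
    finally show "l \<in> ?K"
      using limitin_topspace[OF *(2)] topspace_T by simp
  qed
  then have open_compl: "openin T (H - ?K)"
    unfolding closedin_def topspace_T by (rule conjunct2)
  \<comment> \<open>The complement of the closed cone need not be convex; local convexity supplies a
    convex neighbourhood of \<open>Y\<close> inside it.\<close>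
  have pos: "\<exists>\<phi>\<in>pricing_functionals. 0 < \<phi> Y" if "Y \<in> H" "0 < E Y" for Y
  proof -
    have "Y \<in> H - ?K"
      using that by auto
    then obtain U V where "openin T U" "convex V" "Y \<in> U" "U \<subseteq> V" "V \<subseteq> H - ?K"
      using lc open_compl unfolding locally_convex_topology_def neighbourhood_base_of by meson
    then show ?thesis
      using separation_pricing_functional[OF K K_I K_le, of V U Y] by blast
  qed
  \<comment> \<open>Translation invariance gives \<open>E\<close> the value \<open>1\<close> at the
    constant \<open>1\<close>, so some functional charges it.\<close>
  obtain \<psi> where \<psi>: "\<psi> \<in> pricing_functionals" "0 < \<psi> (const_claim 1)"
    using pos[OF H_const, of 1] E_const[OF H_0, of 1] E_0 by auto
  have "0 < E (X + const_claim (- r))"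
    using E_const[OF X] r by (cases "E X") auto
  then obtain \<phi> where \<phi>: "\<phi> \<in> pricing_functionals" "0 < \<phi> (X + const_claim (- r))"
    using pos[OF H_add[OF X H_const]] by blast
  have "const_claim (- r) = (- r) *\<^sub>R const_claim 1"
    by (simp add: const_claim_def scaleR_fun_def)
  then have "\<phi> (const_claim (- r)) = - r * \<phi> (const_claim 1)"
    using pricing_functionalsD(2)[OF \<phi>(1) H_const] by metis
  then have "r * \<phi> (const_claim 1) < \<phi> X"
    using \<phi>(2) pricing_functionalsD(1)[OF \<phi>(1) X H_const, of "- r"] by simp
  then show ?thesis
    using Q_ac_separation[OF \<phi>(1) \<psi>(1) X] \<psi>(2) by blast
qed

section \<open>Linear agents and the supremum expectation\<close>

lemma pricing_functional_agent:
  assumes \<phi>: "\<phi> \<in> pricing_functionals"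
  shows "(\<lambda>X Y. \<phi> X \<le> \<phi> Y) \<in> agents H T le"
proof -
  have "convex {Z \<in> H. \<phi> X \<le> \<phi> Z}" for X
  proof (rule convexI)
    fix Y Z and u v :: real
    assume *: "Y \<in> {Z \<in> H. \<phi> X \<le> \<phi> Z}" "Z \<in> {Z \<in> H. \<phi> X \<le> \<phi> Z}" "0 \<le> u" "0 \<le> v" "u + v = 1"
    then have "\<phi> X \<le> u * \<phi> Y + v * \<phi> Z"
      \<comment> \<open>A bound from above for convex combinations, applied to the negated
        values.\<close>
      using convex_bound_le[of "- \<phi> Y" "- \<phi> X" "- \<phi> Z" u v] by simp
    then show "u *\<^sub>R Y + v *\<^sub>R Z \<in> {Z \<in> H. \<phi> X \<le> \<phi> Z}"
      using * by (simp add: pricing_functionalsD[OF \<phi>] H_add H_scaleR)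
  qed
  moreover have "\<phi> X \<le> \<phi> Y" if "limitin T Xs X sequentially" "\<And>n. \<phi> (Xs n) \<le> \<phi> Y" for Xs X Y
  proof -
    have "(\<lambda>n. \<phi> (Xs n)) \<longlonglongrightarrow> \<phi> X"
      using continuous_map_limit[OF pricing_functionalsD(3)[OF \<phi>] that(1)] by (simp add: o_def)
    then show ?thesis
      using that(2) by (intro LIMSEQ_le_const2) auto
  qed
  moreover have "transp_on H (\<lambda>X Y. \<phi> X \<le> \<phi> Y)"
    by (rule transp_onI) linarith
  ultimately show ?thesis
    unfolding agents_def using pricing_functionals_mono[OF \<phi>] by auto
qed

text \<open>The family consists of all linear agents with utility in \<open>Q_ac\<close>. As
  \<open>q 0 = 0\<close>, the martingale inequality says that no net trade beats \<open>0\<close>,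
  and \<open>0 < q X\<close> is strict preference.\<close>

lemma Q_ac_positive_imp_viable:
  assumes "\<And>X. X \<in> R \<Longrightarrow> \<exists>q\<in>Q_ac H T le I. 0 < q X"
  shows "viable H T le I R"
proof -
  have Q0: "q 0 = 0" if "q \<in> Q_ac H T le I" for q
    using pricing_functionalsD(2)[OF Q_ac_pricing[OF that] H_0, of 0] by simp
  show ?thesis
    unfolding viable_def
  proof (intro exI conjI ballI)
    let ?A = "(\<lambda>q X Y. q X \<le> (q Y :: real)) ` Q_ac H T le I"
    show "?A \<subseteq> agents H T le"
      using pricing_functional_agent Q_ac_pricing by blast
    show "p l 0" if "p \<in> ?A" "l \<in> I" for p l
    proof -
      obtain q where "q \<in> Q_ac H T le I" "p = (\<lambda>X Y. q X \<le> q Y)"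
        using \<open>p \<in> ?A\<close> by blast
      then show ?thesis
        using Q0[of q] pricing_functionalsD(5)[OF Q_ac_pricing, of q l] \<open>l \<in> I\<close> by simp
    qed
    show "\<exists>p\<in>?A. strict_pref p 0 X" if X: "X \<in> R" for X
    proof -
      obtain q where q: "q \<in> Q_ac H T le I" "0 < q X"
        using assms X by blast
      then have "strict_pref (\<lambda>X Y. q X \<le> q Y) 0 X"
        using Q0[OF q(1)] by (simp add: strict_pref_def)
      then show ?thesis
        using q(1) by blast
    qed
  qed
qed

text \<open>Each property holds for single functionals and passes to the supremum. Nonemptiness
  keeps the supremum away from \<open>-\<infinity>\<close> and lets constants and factors be pulled
  out of it.\<close>

lemma sup_expectation_Q_ac:
  assumes ne: "Q_ac H T le I \<noteq> {}" and pos: "\<And>X. X \<in> R \<Longrightarrow> \<exists>q\<in>Q_ac H T le I. 0 < q X"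
  shows "lsc_martingale_expectation H T le I R (sup_expectation (Q_ac H T le I))"
proof -
  let ?Q = "Q_ac H T le I"
  let ?E = "sup_expectation ?Q"
  note Q = pricing_functionalsD[OF Q_ac_pricing]
  have upper: "ereal (q X) \<le> ?E X" if "q \<in> ?Q" for q X
    using that by (auto simp: sup_expectation_def intro: SUP_upper)
  have least: "?E X \<le> b" if "\<And>q. q \<in> ?Q \<Longrightarrow> ereal (q X) \<le> b" for X b
    using that by (auto simp: sup_expectation_def intro: SUP_least)
  have E_minf: "?E X \<noteq> - \<infinity>" for X
  proof -
    obtain q where "q \<in> ?Q"
      using ne by blast
    then show ?thesis
      using upper[of q X] by auto
  qed
  have "lower_semicontinuous H T ?E"
    unfolding lower_semicontinuous_def
  proof (intro allI impI least)
    fix Xs X q assume lim: "limitin T Xs X sequentially" and q: "q \<in> ?Q"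
    have "(\<lambda>n. q (Xs n)) \<longlonglongrightarrow> q X"
      using continuous_map_limit[OF Q(3)[OF q] lim] by (simp add: o_def)
    then have "(\<lambda>n. ereal (q (Xs n))) \<longlonglongrightarrow> ereal (q X)"
      by simp
    \<comment> \<open>Each \<open>q\<close> is continuous along the sequence, so its limit value is
      bounded by the limit inferior of the suprema.\<close>
    then have "ereal (q X) = liminf (\<lambda>n. ereal (q (Xs n)))"
      by (intro lim_imp_Liminf[symmetric]) simp
    also have "\<dots> \<le> liminf (\<lambda>n. ?E (Xs n))"
      using upper[OF q] by (intro Liminf_mono always_eventually) simp
    finally show "ereal (q X) \<le> liminf (\<lambda>n. ?E (Xs n))" .
  qed
  moreover have "sublinear_expectation H le ?E"
    unfolding sublinear_expectation_def
  proof (intro conjI ballI allI impI E_minf)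
    fix X Y assume "X \<in> H" "Y \<in> H" "le X Y"
    then show "?E X \<le> ?E Y"
      using pricing_functionals_mono[OF Q_ac_pricing] upper
      by (intro least) (meson ereal_less_eq(3) order_trans)
  next
    fix X and c :: real assume X: "X \<in> H"
    have "?E (X + const_claim c) = (SUP q\<in>?Q. ereal (q X) + ereal c)"
      unfolding sup_expectation_def using X
      by (intro SUP_cong refl) (simp add: Q(1) H_const Q_ac_const)
    also have "\<dots> = ?E X + ereal c"
      unfolding sup_expectation_def by (rule SUP_ereal_add_left[OF ne]) simp
    finally show "?E (X + const_claim c) = ?E X + ereal c" .
  next
    fix X Y assume XY: "X \<in> H" "Y \<in> H"
    show "?E (X + Y) \<le> ?E X + ?E Y"
    proof (rule least)
      fix q assume q: "q \<in> ?Q"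
      have "ereal (q (X + Y)) = ereal (q X) + ereal (q Y)"
        using XY by (simp add: Q(1)[OF q])
      also have "\<dots> \<le> ?E X + ?E Y"
        using upper[OF q] by (intro add_mono)
      finally show "ereal (q (X + Y)) \<le> ?E X + ?E Y" .
    qed
  next
    fix X and c :: real assume X: "X \<in> H" and c: "c > 0"
    have "?E (c *\<^sub>R X) = (SUP q\<in>?Q. ereal c * ereal (q X))"
      unfolding sup_expectation_def using X by (intro SUP_cong refl) (simp add: Q(2))
    also have "\<dots> = ereal c * ?E X"
      unfolding sup_expectation_def using c by (intro Sup_ereal_mult_left'[OF ne, symmetric]) simp
    finally show "?E (c *\<^sub>R X) = ereal c * ?E X" .
  qed
  moreover have "martingale_property I ?E"
    unfolding martingale_property_def by (intro ballI least) (simp add: Q(5))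
  moreover have "full_support R ?E"
    unfolding full_support_def
  proof
    fix X assume "X \<in> R"
    then obtain q where "q \<in> ?Q" "0 < q X"
      using pos by blast
    then show "0 < ?E X"
      using upper[of q X] by (meson ereal_less(2) less_le_trans)
  qed
  ultimately show ?thesis
    unfolding lsc_martingale_expectation_def by blast
qed

end

section \<open>Viability, existence of expectations and maximality\<close>

theorem theorem2p2:
  fixes M :: "'w measure"
    and H :: "('w \<Rightarrow> real) set"
    and T :: "('w \<Rightarrow> real) topology"
    and le :: "('w \<Rightarrow> real) \<Rightarrow> ('w \<Rightarrow> real) \<Rightarrow> bool"
    and I R :: "('w \<Rightarrow> real) set"
  assumes "financial_market M H T le I R"
  shows
    "(locally_convex_topology T \<longrightarrow>
        (viable H T le I R \<longleftrightarrow> (\<exists>E. lsc_martingale_expectation H T le I R E))) \<and>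
     (viable H T le I R \<longrightarrow>
        Q_ac H T le I \<noteq> {} \<and>
        lsc_martingale_expectation H T le I R (sup_expectation (Q_ac H T le I)) \<and>
        (locally_convex_topology T \<longrightarrow>
           (\<forall>E. lsc_martingale_expectation H T le I R E \<longrightarrow>
              (\<forall>X\<in>H. E X \<le> sup_expectation (Q_ac H T le I) X))))"
proof -
  interpret financial_market M H T le I R
    by (rule assms)
  \<comment> \<open>The relevant constant \<open>1\<close> guarantees that some functional
    exists.\<close>
  have Q: "Q_ac H T le I \<noteq> {}" if "viable H T le I R"
    using viable_imp_Q_ac_positive[OF that R_const[of 1]] by auto
  have sup: "lsc_martingale_expectation H T le I R (sup_expectation (Q_ac H T le I))"
    if "viable H T le I R"
    using sup_expectation_Q_ac[OF Q[OF that]] viable_imp_Q_ac_positive[OF that] by blast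
  have "viable H T le I R"
    if lc: "locally_convex_topology T" and E: "lsc_martingale_expectation H T le I R E" for E
  proof (rule Q_ac_positive_imp_viable)
    fix X assume X: "X \<in> R"
    then have "ereal 0 < E X"
      using E by (simp add: lsc_martingale_expectation_def full_support_def flip: zero_ereal_def)
    then show "\<exists>q\<in>Q_ac H T le I. 0 < q X"
      using lsc_martingale_expectation_le_Q_ac[OF E lc] X R_H by blast
  qed
  moreover have "E X \<le> sup_expectation (Q_ac H T le I) X"
    if "locally_convex_topology T" "lsc_martingale_expectation H T le I R E" "X \<in> H" for E X
  proof (rule ereal_le_real)
    \<comment> \<open>Testing against real upper bounds \<open>z\<close> of the supremum also covers
      infinite values; a failing \<open>z\<close> would be exceeded by some functional in
      \<open>Q_ac\<close>.\<close>
    show "E X \<le> ereal z" if z: "sup_expectation (Q_ac H T le I) X \<le> ereal z" for z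
    proof (rule ccontr)
      assume "\<not> ?thesis"
      then have "ereal z < E X"
        by simp
      then obtain q where "q \<in> Q_ac H T le I" "z < q X"
        using lsc_martingale_expectation_le_Q_ac[OF \<open>lsc_martingale_expectation H T le I R E\<close>
            \<open>locally_convex_topology T\<close> \<open>X \<in> H\<close>, of z] by blast
      moreover have "ereal (q X) \<le> sup_expectation (Q_ac H T le I) X" if "q \<in> Q_ac H T le I" for q
        using that by (auto simp: sup_expectation_def intro: SUP_upper)
      ultimately show False
        using z by (metis ereal_less_eq(3) not_le order_trans)
    qed
  qed
  ultimately show ?thesis
    using Q sup by blast
qed

end
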